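(* For any two finite simple undirected graphs $G_1=(V_1,E_1)$ and $G_2=(V_2,E_2)$, the lexicographic product $G_1[G_2]$ satisfies \[\operatorname{nlcw}(G_1[G_2]) = \max(\operatorname{nlcw}(G_1),\operatorname{nlcw}(G_2))\quad\text{and}\quad \operatorname{cw}(G_1[G_2]) = \max(\operatorname{cw}(G_1),\operatorname{cw}(G_2)).\]
   Context: Lexicographic product: $G_1[G_2]$ has vertex set $V_1\times V_2$, and $(u_1,u_2)$, $(v_1,v_2)$ are adjacent iff $\{u_1,v_1\}\in E_1$, or ($u_1=v_1$ and $\{u_2,v_2\}\in E_2$). Clique-width: for a positive integer $k$, $\mathrm{CW}_k$ is the smallest class of graphs whose vertices carry labels from $\{1,\dots,k\}$ that contains every single-vertex graph with any label $a\in\{1,\dots,k\}$ and is closed under: disjoint union $G\oplus J$ of two vertex-disjoint labeled graphs (labels kept); relabeling $\rho_{a\to b}$ for $a\neq b$ (every vertex labeled $a$ gets label $b$); and $\eta_{a,b}$ for $a\neq b$ (add all edges between a vertex labeled $a$ and a vertex labeled $b$). The clique-width $\operatorname{cw}(G)$ of a graph is the least $k$ such that some labeling of $G$ lies in $\mathrm{CW}_k$. NLC-width: $\mathrm{NLC}_k$ is the smallest class of labeled graphs (labels in $\{1,\dots,k\}$) that contains every single-vertex graph with any label and is closed under: $G\times_S J$ for $S\subseteq\{1,\dots,k\}^2$ (disjoint union of vertex-disjoint $G$ and $J$, plus all edges $\{u,v\}$ with $u\in V_G$, $v\in V_J$ and $(\mathrm{lab}(u),\mathrm{lab}(v))\in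 S$); and $\circ_R$ for a function $R:\{1,\dots,k\}\to\{1,\dots,k\}$ (each label $a$ replaced by $R(a)$). The NLC-width $\operatorname{nlcw}(G)$ is the least $k$ such that some labeling of $G$ lies in $\mathrm{NLC}_k$. *)

theory Defs
  imports Main "HOL-Library.FuncSet" "HOL-Library.Extended_Nat"
begin

type_synonym 'a graph = "'a set \<times> 'a set set"

definition simple_graph :: "'a graph \<Rightarrow> bool" where
  "simple_graph G \<longleftrightarrow> finite (fst G) \<and>
     snd G \<subseteq> {{u, v} | u v. u \<in> fst G \<and> v \<in> fst G \<and> u \<noteq> v}"

definition lex_product :: "'a graph \<Rightarrow> 'b graph \<Rightarrow> ('a \<times> 'b) graph" where
  "lex_product G1 G2 =
     (fst G1 \<times> fst G2,
      {{(u1, u2), (v1, v2)} | u1 u2 v1 v2.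
         u1 \<in> fst G1 \<and> v1 \<in> fst G1 \<and> u2 \<in> fst G2 \<and> v2 \<in> fst G2 \<and>
         ({u1, v1} \<in> snd G1 \<or> (u1 = v1 \<and> {u2, v2} \<in> snd G2))})"

text \<open>
  In a labeled graph \<open>(V, E, l)\<close> only the values of \<open>l\<close> on \<open>V\<close> are meaningful. None of the
  operations below deletes vertices, so every labeled graph occurring in the construction of a graph
  has its vertices among those of the final graph; no closure under isomorphism is needed.
\<close>

type_synonym 'a labeled_graph = "'a set \<times> 'a set set \<times> ('a \<Rightarrow> nat)"

inductive_set CW :: "nat \<Rightarrow> 'a labeled_graph set" for k :: nat where
  single: "l v \<in> {1..k} \<Longrightarrow> ({v}, {}, l) \<in> CW k"
| union: "(V, E, l) \<in> CW k \<Longrightarrow> (V', E', l') \<in> CW k \<Longrightarrow> V \<inter> V' = {} \<Longrightarrow>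
    (V \<union> V', E \<union> E', \<lambda>v. if v \<in> V then l v else l' v) \<in> CW k"
| relabel: "(V, E, l) \<in> CW k \<Longrightarrow> a \<in> {1..k} \<Longrightarrow> b \<in> {1..k} \<Longrightarrow> a \<noteq> b \<Longrightarrow>
    (V, E, \<lambda>v. if l v = a then b else l v) \<in> CW k"
| join: "(V, E, l) \<in> CW k \<Longrightarrow> a \<in> {1..k} \<Longrightarrow> b \<in> {1..k} \<Longrightarrow> a \<noteq> b \<Longrightarrow>
    (V, E \<union> {{u, v} | u v. u \<in> V \<and> v \<in> V \<and> l u = a \<and> l v = b}, l) \<in> CW k"

inductive_set NLC :: "nat \<Rightarrow> 'a labeled_graph set" for k :: nat where
  single: "l v \<in> {1..k} \<Longrightarrow> ({v}, {}, l) \<in> NLC k"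
| union: "(V, E, l) \<in> NLC k \<Longrightarrow> (V', E', l') \<in> NLC k \<Longrightarrow> V \<inter> V' = {} \<Longrightarrow>
    S \<subseteq> {1..k} \<times> {1..k} \<Longrightarrow>
    (V \<union> V', E \<union> E' \<union> {{u, v} | u v. u \<in> V \<and> v \<in> V' \<and> (l u, l' v) \<in> S},
     \<lambda>v. if v \<in> V then l v else l' v) \<in> NLC k"
| relabel: "(V, E, l) \<in> NLC k \<Longrightarrow> R \<in> {1..k} \<rightarrow> {1..k} \<Longrightarrow>
    (V, E, \<lambda>v. R (l v)) \<in> NLC k"

text \<open>
  The operations never produce a graph without vertices, so the empty graph has no width in
  \<open>\<nat>\<close>; its width is \<open>\<infinity>\<close>, the infimum of the empty set. For nonempty finite
  simple graphs the widths are the least natural numbers in question, as shown at the end.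
\<close>

definition clique_width :: "'a graph \<Rightarrow> enat" where
  "clique_width G = Inf (enat ` {k. k \<ge> 1 \<and> (\<exists>l. (fst G, snd G, l) \<in> CW k)})"

definition nlc_width :: "'a graph \<Rightarrow> enat" where
  "nlc_width G = Inf (enat ` {k. k \<ge> 1 \<and> (\<exists>l. (fst G, snd G, l) \<in> NLC k)})"

lemma Inf_enat_image_eq_Least:
  assumes "\<exists>k. P k"
  shows "Inf (enat ` {k. P k}) = enat (LEAST k. P k)"
proof (rule antisym)
  show "Inf (enat ` {k. P k}) \<le> enat (LEAST k. P k)"
    using assms by (intro Inf_lower) (auto intro: LeastI_ex)
  show "enat (LEAST k. P k) \<le> Inf (enat ` {k. P k})"
    by (intro Inf_greatest) (auto intro: Least_le)
qed

lemma CW_edgeless: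
  assumes "finite V" "V \<noteq> {}" "\<And>v. v \<in> V \<Longrightarrow> l v \<in> {1..k}"
  shows "(V, {}, l) \<in> CW k"
  using assms
proof (induction V rule: finite_ne_induct)
  case (singleton v)
  then show ?case by (auto intro: CW.single)
next
  case (insert v V)
  have "({v} \<union> V, {} \<union> {}, \<lambda>w. if w \<in> {v} then l w else l w) \<in> CW k"
    using insert by (intro CW.union CW.single) auto
  then show ?case by simp
qed

lemma CW_exists:
  assumes "simple_graph G" "fst G \<noteq> {}"
  shows "\<exists>k\<ge>1. \<exists>l. (fst G, snd G, l) \<in> CW k"
proof -
  obtain V E where G: "G = (V, E)" by (cases G)
  have fin: "finite V" and ne: "V \<noteq> {}"
    and E: "E \<subseteq> {{u, v} | u v. u \<in> V \<and> v \<in> V \<and> u \<noteq> v}"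
    using assms by (auto simp: simple_graph_def G)
  obtain l where l: "bij_betw l V {1..card V}"
    using fin by (metis finite_same_card_bij finite_atLeastAtMost card_atLeastAtMost diff_Suc_1)
  have lk: "\<And>v. v \<in> V \<Longrightarrow> l v \<in> {1..card V}" and inj: "inj_on l V"
    using l by (auto simp: bij_betw_def)
  have "finite E" using fin E by (auto intro: finite_subset[of E "Pow V"])
  then have "(V, E, l) \<in> CW (card V)" using E
  proof (induction E rule: finite_induct)
    case empty
    then show ?case using fin ne lk by (intro CW_edgeless) auto
  next
    case (insert e E)
    then obtain u v where e: "e = {u, v}" "u \<in> V" "v \<in> V" "u \<noteq> v" by auto
    have "l u \<noteq> l v" using inj e by (auto dest: inj_onD)
    then have "(V, E \<union> {{x, y} | x y. x \<in> V \<and> y \<in> V \<and> l x = l u \<and> l y = l v}, l)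
        \<in> CW (card V)"
      using insert e lk by (intro CW.join) auto
    moreover have "{{x, y} | x y. x \<in> V \<and> y \<in> V \<and> l x = l u \<and> l y = l v} = {e}"
      using e inj by (auto dest: inj_onD)
    ultimately show ?case by simp
  qed
  moreover have "card V \<ge> 1" using fin ne by (simp add: Suc_le_eq card_gt_0_iff)
  ultimately show ?thesis by (auto simp: G)
qed

lemma NLC_induced:
  assumes "finite V" "V \<noteq> {}" "\<And>v. v \<in> V \<Longrightarrow> l v \<in> {1..k}" "inj_on l V"
    and E: "\<And>e. e \<in> E \<Longrightarrow> \<exists>u v. e = {u, v} \<and> u \<noteq> v"
  shows "(V, {e \<in> E. e \<subseteq> V}, l) \<in> NLC k"
  using assms(1-4)
proof (induction V rule: finite_ne_induct)
  case (singleton v)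
  have "{e \<in> E. e \<subseteq> {v}} = {}" using E by fastforce
  moreover have "({v}, {}, l) \<in> NLC k" using singleton by (intro NLC.single) auto
  ultimately show ?case by (simp only:)
next
  case (insert v V)
  define S where "S = {(l v, l w) | w. w \<in> V \<and> {v, w} \<in> E}"
  have "({v} \<union> V, {} \<union> {e \<in> E. e \<subseteq> V} \<union> {{x, y} | x y. x \<in> {v} \<and> y \<in> V \<and> (l x, l y) \<in> S},
      \<lambda>w. if w \<in> {v} then l w else l w) \<in> NLC k"
    using insert by (intro NLC.union NLC.single) (auto simp: S_def)
  moreover have "{{x, y} | x y. x \<in> {v} \<and> y \<in> V \<and> (l x, l y) \<in> S} =
      {{v, y} | y. y \<in> V \<and> {v, y} \<in> E}"
  proof -
    have "(l v, l y) \<in> S \<longleftrightarrow> {v, y} \<in> E" if "y \<in> V" for y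
      using that insert.prems(2) by (auto simp: S_def dest: inj_onD)
    then show ?thesis by blast
  qed
  moreover have "{e \<in> E. e \<subseteq> V} \<union> {{v, y} | y. y \<in> V \<and> {v, y} \<in> E} = {e \<in> E. e \<subseteq> insert v V}"
  proof -
    have "e \<subseteq> V \<or> (\<exists>y. e = {v, y} \<and> y \<in> V)" if "e \<in> E" "e \<subseteq> insert v V" for e
      using E[OF that(1)] that(2) by (auto simp: doubleton_eq_iff)
    then show ?thesis by auto
  qed
  ultimately show ?case by simp
qed

lemma NLC_exists:
  assumes "simple_graph G" "fst G \<noteq> {}"
  shows "\<exists>k\<ge>1. \<exists>l. (fst G, snd G, l) \<in> NLC k"
proof -
  have fin: "finite (fst G)"
    and E: "snd G \<subseteq> {{u, v} | u v. u \<in> fst G \<and> v \<in> fst G \<and> u \<noteq> v}"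
    using assms by (auto simp: simple_graph_def)
  obtain l where l: "bij_betw l (fst G) {1..card (fst G)}"
    using fin by (metis finite_same_card_bij finite_atLeastAtMost card_atLeastAtMost diff_Suc_1)
  have "(fst G, {e \<in> snd G. e \<subseteq> fst G}, l) \<in> NLC (card (fst G))"
  proof (rule NLC_induced)
    show "\<exists>u v. e = {u, v} \<and> u \<noteq> v" if "e \<in> snd G" for e using that E by blast
  qed (use fin assms l in \<open>auto simp: bij_betw_def\<close>)
  moreover have "{e \<in> snd G. e \<subseteq> fst G} = snd G" using E by auto
  moreover have "card (fst G) \<ge> 1" using fin assms by (simp add: Suc_le_eq card_gt_0_iff)
  ultimately show ?thesis by auto
qed

lemma clique_width_eq_Least:
  assumes "simple_graph G" "fst G \<noteq> {}"
  shows "clique_width G = enat (LEAST k. k \<ge> 1 \<and> (\<exists>l. (fst G, snd G, l) \<in> CW k))"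
  unfolding clique_width_def using CW_exists[OF assms] by (intro Inf_enat_image_eq_Least) auto

lemma nlc_width_eq_Least:
  assumes "simple_graph G" "fst G \<noteq> {}"
  shows "nlc_width G = enat (LEAST k. k \<ge> 1 \<and> (\<exists>l. (fst G, snd G, l) \<in> NLC k))"
  unfolding nlc_width_def using NLC_exists[OF assms] by (intro Inf_enat_image_eq_Least) auto

end

theory Submission
  imports Defs
begin

text \<open>
  Upper bound: in an expression for \<open>G1\<close>, replace every leaf \<open>v\<close> by an expression for the copy
  \<open>{v} \<times> G2\<close>, followed by relabelings that give all vertices of the copy the label of \<open>v\<close>. The
  remaining operations then treat each copy as a single vertex. Lower bound: \<open>G1\<close> and \<open>G2\<close> embed
  as induced subgraphs in the product, and expressions restrict to induced subgraphs.
\<close>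

section \<open>Edge sets under restriction and substitution\<close>

text \<open>For \<open>f\<close> injective on \<open>W\<close> this is the subgraph induced on the
  image of \<open>W\<close>, carried back to \<open>W\<close>. It serves both directions of the
  proof: embeddings of a factor into the product, and \<open>snd\<close> on one copy
  \<open>{v} \<times> W\<close>.\<close>

definition pullback :: "('b \<Rightarrow> 'a) \<Rightarrow> 'b set \<Rightarrow> 'a set set \<Rightarrow> 'b set set" where
  "pullback f W E = {e. e \<subseteq> W \<and> f ` e \<in> E}"

lemma pullback_Un: "pullback f W (E \<union> E') = pullback f W E \<union> pullback f W E'"
  by (auto simp: pullback_def)

lemma pullback_empty [simp]: "pullback f W {} = {}"
  by (simp add: pullback_def)

lemma pullback_restrict: "E \<subseteq> Pow V \<Longrightarrow> pullback f {w \<in> W. f w \<in> V} E = pullback f W E"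
  by (auto simp: pullback_def)

text \<open>The image of a pulled-back edge would be nonempty and lie both in \<open>V\<close> and
  in the image of \<open>W\<close>. This covers a union in which one operand loses all its
  vertices.\<close>

lemma pullback_disjoint:
  assumes "E \<subseteq> Pow V" "{} \<notin> E" "f ` W \<inter> V = {}"
  shows "pullback f W E = {}"
proof -
  have False if "e \<subseteq> W" "f ` e \<in> E" for e
  proof -
    have "f ` e \<subseteq> f ` W \<inter> V" "f ` e \<noteq> {}" using that assms(1,2) by (blast, metis)
    then show False using assms(3) by blast
  qed
  then show ?thesis by (auto simp: pullback_def)
qed

text \<open>Choosing preimages \<open>x\<close>, \<open>y\<close> of \<open>u\<close>,
  \<open>v\<close> inside \<open>e\<close>, injectivity cancels \<open>f\<close> from the equality
  of the images of \<open>e\<close> and \<open>{x, y}\<close>. The case \<open>u = v\<close> is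
  included. Pullback thereby commutes with every operation that adds edges.\<close>

lemma pullback_pairs:
  assumes "inj_on f W"
  shows "pullback f W {{u, v} | u v. P u v} = {{u, v} | u v. u \<in> W \<and> v \<in> W \<and> P (f u) (f v)}"
proof -
  have "\<exists>x y. e = {x, y} \<and> x \<in> W \<and> y \<in> W \<and> P (f x) (f y)"
    if e: "e \<subseteq> W" "f ` e = {u, v}" "P u v" for e u v
  proof -
    obtain x y where xy: "x \<in> e" "y \<in> e" "u = f x" "v = f y"
      using e(2) by (metis imageE insertI1 insertI2)
    then have "f ` e = f ` {x, y}" using e by simp
    then have "e = {x, y}" using assms e(1) xy inj_on_image_eq_iff[OF assms, of e "{x, y}"] by blast
    then show ?thesis using xy e by blast
  qed
  then show ?thesis by (fastforce simp: pullback_def)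
qed

text \<open>The four sets are separate arguments so that \<open>V\<close> and \<open>E\<close> can
  run through the intermediate graphs of an expression. Pairs \<open>p\<close>, \<open>q\<close>
  with projections match the shape of \<open>pullback_pairs\<close>.\<close>

definition lex_edges :: "'a set \<Rightarrow> 'a set set \<Rightarrow> 'b set \<Rightarrow> 'b set set \<Rightarrow> ('a \<times> 'b) set set" where
  "lex_edges V E W F = {{p, q} | p q. p \<in> V \<times> W \<and> q \<in> V \<times> W \<and>
     ({fst p, fst q} \<in> E \<or> fst p = fst q \<and> {snd p, snd q} \<in> F)}"

lemma lex_product_eq: "lex_product G1 G2 = (fst G1 \<times> fst G2, lex_edges (fst G1) (snd G1) (fst G2) (snd G2))"
  unfolding lex_product_def lex_edges_def by fastforce

text \<open>Both ends of an edge of \<open>E\<close> lie in \<open>V\<close>, both ends of an edge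
  of \<open>E'\<close> lie in \<open>V'\<close>, and an edge inside a copy has a single first
  component; so each product edge stays on one side.\<close>

lemma lex_edges_Un:
  assumes "E \<subseteq> Pow V" "E' \<subseteq> Pow V'"
  shows "lex_edges (V \<union> V') (E \<union> E') W F = lex_edges V E W F \<union> lex_edges V' E' W F"
  (is "?L = ?R")
proof
  show "?L \<subseteq> ?R"
  proof
    fix e assume "e \<in> ?L"
    then obtain p q where e: "e = {p, q}" "p \<in> (V \<union> V') \<times> W" "q \<in> (V \<union> V') \<times> W"
      "{fst p, fst q} \<in> E \<or> {fst p, fst q} \<in> E' \<or> fst p = fst q \<and> {snd p, snd q} \<in> F"
      unfolding lex_edges_def by blast
    have V: "{fst p, fst q} \<in> E \<Longrightarrow> fst p \<in> V \<and> fst q \<in> V"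
      "{fst p, fst q} \<in> E' \<Longrightarrow> fst p \<in> V' \<and> fst q \<in> V'" using assms by auto
    have W: "snd p \<in> W" "snd q \<in> W" "fst p \<in> V \<union> V'" using e by auto
    consider "p \<in> V \<times> W" "q \<in> V \<times> W" "{fst p, fst q} \<in> E \<or> fst p = fst q \<and> {snd p, snd q} \<in> F"
      | "p \<in> V' \<times> W" "q \<in> V' \<times> W" "{fst p, fst q} \<in> E' \<or> fst p = fst q \<and> {snd p, snd q} \<in> F"
      using e(4) V W by (auto simp: mem_Times_iff)
    then show "e \<in> ?R" unfolding lex_edges_def e(1) by cases blast+
  qed
  show "?R \<subseteq> ?L" unfolding lex_edges_def by blast
qed

text \<open>An edge added between \<open>u\<close> and \<open>v\<close> in the first graph becomes
  all edges between the copies of \<open>u\<close> and \<open>v\<close>.\<close>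

lemma lex_edges_pairs:
  assumes "\<And>u v. P u v \<Longrightarrow> u \<in> V \<and> v \<in> V"
  shows "lex_edges V (E \<union> {{u, v} | u v. P u v}) W F =
    lex_edges V E W F \<union> {{p, q} | p q. snd p \<in> W \<and> snd q \<in> W \<and> P (fst p) (fst q)}"
  (is "?L = ?R")
proof
  show "?L \<subseteq> ?R"
  proof
    fix e assume "e \<in> ?L"
    then obtain p q where e: "e = {p, q}" "p \<in> V \<times> W" "q \<in> V \<times> W"
      "{fst p, fst q} \<in> E \<union> {{u, v} | u v. P u v} \<or> fst p = fst q \<and> {snd p, snd q} \<in> F"
      unfolding lex_edges_def by blast
    have W: "snd p \<in> W" "snd q \<in> W" using e(2,3) by auto
    \<comment> \<open>An unordered pair can match \<open>{u, v}\<close> in two orientations; the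
      reversed one is absorbed by writing \<open>e\<close> as \<open>{q, p}\<close>.\<close>
    consider "{fst p, fst q} \<in> E \<or> fst p = fst q \<and> {snd p, snd q} \<in> F"
      | "P (fst p) (fst q)" | "P (fst q) (fst p)"
      using e(4) by (auto simp: doubleton_eq_iff)
    then show "e \<in> ?R"
    proof cases
      case 1
      then show ?thesis using e(1-3) unfolding lex_edges_def by blast
    next
      case 2
      then show ?thesis using e(1) W by blast
    next
      case 3
      moreover have "e = {q, p}" using e(1) by auto
      ultimately show ?thesis using W by blast
    qed
  qed
  show "?R \<subseteq> ?L"
  proof -
    have "{p, q} \<in> ?L" if "snd p \<in> W" "snd q \<in> W" "P (fst p) (fst q)" for p q
    proof -
      have "p \<in> V \<times> W" "q \<in> V \<times> W" using assms that by (auto simp: mem_Times_iff)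
      then show ?thesis using that unfolding lex_edges_def by blast
    qed
    then show ?thesis unfolding lex_edges_def by blast
  qed
qed

text \<open>Over one vertex only the clause for equal first components survives, so the product is a
  copy of the second graph, and \<open>snd\<close> is the isomorphism. This is the base case of the
  upper bound.\<close>

lemma lex_edges_single:
  assumes "F \<subseteq> {{x, y} | x y. x \<in> W \<and> y \<in> W \<and> x \<noteq> y}"
  shows "lex_edges {v} {} W F = pullback snd ({v} \<times> W) F"
proof -
  \<comment> \<open>This puts \<open>F\<close> in the form of a set of pairs, to which
    \<open>pullback_pairs\<close> applies.\<close>
  have "F = {{x, y} | x y. {x, y} \<in> F}" using assms by blast
  then have "pullback snd ({v} \<times> W) F = pullback snd ({v} \<times> W) {{x, y} | x y. {x, y} \<in> F}" by simp
  also have "\<dots> = {{p, q} | p q. p \<in> {v} \<times> W \<and> q \<in> {v} \<times> W \<and> {snd p, snd q} \<in> F}"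
    by (rule pullback_pairs) (auto simp: inj_on_def)
  also have "\<dots> = lex_edges {v} {} W F" unfolding lex_edges_def by fastforce
  finally show ?thesis by simp
qed

lemma pullback_lex_fst:
  assumes E: "E \<subseteq> {{u, v} | u v. u \<in> V \<and> v \<in> V \<and> u \<noteq> v}"
    and F: "F \<subseteq> {{u, v} | u v. u \<in> W \<and> v \<in> W \<and> u \<noteq> v}" and y: "y \<in> W"
  shows "pullback (\<lambda>u. (u, y)) V (lex_edges V E W F) = E"
proof -
  \<comment> \<open>On the slice with second component \<open>y\<close>, the clause for equal first
    components asks for \<open>{y, y} \<in> F\<close>; absence of loops removes it.\<close>
  have "{y, y} \<notin> F" using F by (auto simp: doubleton_eq_iff)
  then have "pullback (\<lambda>u. (u, y)) V (lex_edges V E W F) = {{u, v} | u v. u \<in> V \<and> v \<in> V \<and> {u, v} \<in> E}"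
    unfolding lex_edges_def using y by (subst pullback_pairs) (auto simp: inj_on_def)
  also have "\<dots> = E" using E by blast
  finally show ?thesis .
qed

lemma pullback_lex_snd:
  assumes E: "E \<subseteq> {{u, v} | u v. u \<in> V \<and> v \<in> V \<and> u \<noteq> v}"
    and F: "F \<subseteq> {{u, v} | u v. u \<in> W \<and> v \<in> W \<and> u \<noteq> v}" and x: "x \<in> V"
  shows "pullback (Pair x) W (lex_edges V E W F) = F"
proof -
  \<comment> \<open>On a single copy the first clause asks for a loop at \<open>x\<close>, so only
    the edges of \<open>F\<close> remain.\<close>
  have "{x, x} \<notin> E" using E by (auto simp: doubleton_eq_iff)
  then have "pullback (Pair x) W (lex_edges V E W F) = {{u, v} | u v. u \<in> W \<and> v \<in> W \<and> {u, v} \<in> F}"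
    unfolding lex_edges_def using x by (subst pullback_pairs) (auto simp: inj_on_def)
  also have "\<dots> = F" using F by blast
  finally show ?thesis .
qed

section \<open>Clique-width expressions\<close>

text \<open>Membership in \<open>CW k\<close> that does not depend on the junk labels outside \<open>V\<close>.\<close>

definition cw_graph :: "nat \<Rightarrow> 'a set \<Rightarrow> 'a set set \<Rightarrow> ('a \<Rightarrow> nat) \<Rightarrow> bool" where
  "cw_graph k V E l \<longleftrightarrow> (\<exists>l'. (\<forall>v\<in>V. l' v = l v) \<and> (V, E, l') \<in> CW k)"

section \<open>Clique-width operations with labels considered only on the vertex set\<close>

lemma CW_imp_cw_graph: "(V, E, l) \<in> CW k \<Longrightarrow> cw_graph k V E l"
  by (auto simp: cw_graph_def)

lemma cw_graph_cong: "cw_graph k V E l \<Longrightarrow> (\<And>v. v \<in> V \<Longrightarrow> l v = l' v) \<Longrightarrow> cw_graph k V E l'"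
  by (auto simp: cw_graph_def)

lemma cw_graph_single: "l v \<in> {1..k} \<Longrightarrow> cw_graph k {v} {} l"
  by (intro CW_imp_cw_graph CW.single)

text \<open>One labeling serves both operands, which avoids the conditional of
  \<open>CW.union\<close>; disjointness allows the two witnesses to be glued.\<close>

lemma cw_graph_union:
  assumes "cw_graph k V E l" "cw_graph k V' E' l" "V \<inter> V' = {}"
  shows "cw_graph k (V \<union> V') (E \<union> E') l"
proof -
  obtain m m' where "\<forall>v\<in>V. m v = l v" "(V, E, m) \<in> CW k" "\<forall>v\<in>V'. m' v = l v" "(V', E', m') \<in> CW k"
    using assms by (auto simp: cw_graph_def)
  then show ?thesis using assms(3) unfolding cw_graph_def
    by (intro exI[of _ "\<lambda>v. if v \<in> V then m v else m' v"] conjI CW.union) auto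
qed

lemma cw_graph_relabel:
  assumes "cw_graph k V E l" "a \<in> {1..k}" "b \<in> {1..k}" "a \<noteq> b"
  shows "cw_graph k V E (\<lambda>v. if l v = a then b else l v)"
proof -
  obtain m where "\<forall>v\<in>V. m v = l v" "(V, E, m) \<in> CW k"
    using assms by (auto simp: cw_graph_def)
  then show ?thesis using assms(2-) unfolding cw_graph_def
    by (intro exI[of _ "\<lambda>v. if m v = a then b else m v"] conjI CW.relabel) auto
qed

lemma cw_graph_join:
  assumes "cw_graph k V E l" "a \<in> {1..k}" "b \<in> {1..k}" "a \<noteq> b"
  shows "cw_graph k V (E \<union> {{u, v} | u v. u \<in> V \<and> v \<in> V \<and> l u = a \<and> l v = b}) l"
proof -
  obtain m where m: "\<forall>v\<in>V. m v = l v" "(V, E, m) \<in> CW k"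
    using assms by (auto simp: cw_graph_def)
  have "{{u, v} | u v. u \<in> V \<and> v \<in> V \<and> m u = a \<and> m v = b} =
      {{u, v} | u v. u \<in> V \<and> v \<in> V \<and> l u = a \<and> l v = b}"
    using m(1) by metis
  then show ?thesis using CW.join[of V E m k a b] assms m unfolding cw_graph_def by auto
qed

text \<open>A join uses two different labels, so its new edges have different ends and no loop
  arises.\<close>

lemma CW_wf:
  assumes "(V, E, l) \<in> CW k"
  shows "V \<noteq> {} \<and> E \<subseteq> {{u, v} | u v. u \<in> V \<and> v \<in> V \<and> u \<noteq> v} \<and> l ` V \<subseteq> {1..k}"
  using assms
proof induction
  case (union V E l V' E' l')
  then show ?case by (simp add: image_subset_iff) blast
qed auto

lemma CW_edges_subset: "(V, E, l) \<in> CW k \<Longrightarrow> E \<subseteq> Pow V \<and> {} \<notin> E"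
  using CW_wf[of V E l k] by fast

lemma CW_mono:
  assumes "(V, E, l) \<in> CW k" "k \<le> k'"
  shows "(V, E, l) \<in> CW k'"
  using assms(1)
proof induction
  case (single l v) then show ?case using assms(2) by (intro CW.single) auto
next
  case (union V E l V' E' l') then show ?case by (intro CW.union)
next
  case (relabel V E l a b) then show ?case using assms(2) by (intro CW.relabel) auto
next
  case (join V E l a b) then show ?case using assms(2) by (intro CW.join) auto
qed

text \<open>Expressions restrict to induced subgraphs: leaves outside the image of \<open>W\<close>
  are dropped and all other operations are kept. \<open>W\<close> must be nonempty because no
  expression yields the empty graph, and it varies in the induction because a union splits
  it.\<close>

lemma cw_graph_pullback:
  assumes "(V, E, l) \<in> CW k" "inj_on f W" "f ` W \<subseteq> V" "W \<noteq> {}"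
  shows "cw_graph k W (pullback f W E) (l \<circ> f)"
  using assms
proof (induction arbitrary: W)
  case (single l v)
  obtain w where "w \<in> W" using single.prems(3) by blast
  then have "W = {w}" "f w = v" using single.prems by (auto dest: inj_onD)
  then show ?case using single by (auto intro: cw_graph_single)
next
  case (union V E l V' E' l')
  define W1 where "W1 = {w \<in> W. f w \<in> V}"
  define W2 where "W2 = {w \<in> W. f w \<in> V'}"
  have W: "W = W1 \<union> W2" "W1 \<inter> W2 = {}" "inj_on f W1" "inj_on f W2" "f ` W1 \<subseteq> V" "f ` W2 \<subseteq> V'"
    using union.prems union.hyps by (auto simp: W1_def W2_def intro: inj_on_subset)
  let ?l = "(\<lambda>v. if v \<in> V then l v else l' v) \<circ> f"
  have left: "cw_graph k W1 (pullback f W E) ?l" if "W1 \<noteq> {}"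
  proof -
    have "pullback f W1 E = pullback f W E"
      unfolding W1_def using CW_edges_subset[OF union.hyps(1)] by (intro pullback_restrict) blast
    then have "cw_graph k W1 (pullback f W E) (l \<circ> f)"
      using union.IH(1)[OF W(3,5) that] by (simp only:)
    then show ?thesis by (rule cw_graph_cong) (use union.hyps(3) in \<open>auto simp: W1_def\<close>)
  qed
  have right: "cw_graph k W2 (pullback f W E') ?l" if "W2 \<noteq> {}"
  proof -
    have "pullback f W2 E' = pullback f W E'"
      unfolding W2_def using CW_edges_subset[OF union.hyps(2)] by (intro pullback_restrict) blast
    then have "cw_graph k W2 (pullback f W E') (l' \<circ> f)"
      using union.IH(2)[OF W(4,6) that] by (simp only:)
    then show ?thesis by (rule cw_graph_cong) (use union.hyps(3) in \<open>auto simp: W2_def\<close>)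
  qed
  \<comment> \<open>If one operand loses all its vertices, the union node is replaced by the other
    operand.\<close>
  consider "W1 = {}" "W2 = W" | "W2 = {}" "W1 = W" | "W1 \<noteq> {}" "W2 \<noteq> {}" using W by auto
  then show ?case
  proof cases
    case 1
    then have "pullback f W E = {}"
      using CW_edges_subset[OF union.hyps(1)] by (intro pullback_disjoint[of E V]) (auto simp: W1_def)
    with right 1 show ?thesis using union.prems(3) by (simp add: pullback_Un comp_def)
  next
    case 2
    then have "pullback f W E' = {}"
      using CW_edges_subset[OF union.hyps(2)] by (intro pullback_disjoint[of E' V']) (auto simp: W2_def)
    with left 2 show ?thesis using union.prems(3) by (simp add: pullback_Un comp_def)
  next
    case 3
    then show ?thesis using cw_graph_union[OF left right] W by (simp add: pullback_Un comp_def)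
  qed
next
  case (relabel V E l a b)
  show ?case using cw_graph_relabel[OF relabel.IH[OF relabel.prems] relabel.hyps(2-)] by (simp only: comp_def)
next
  case (join V E l a b)
  have "u \<in> W \<and> v \<in> W \<and> f u \<in> V \<and> f v \<in> V \<and> l (f u) = a \<and> l (f v) = b \<longleftrightarrow>
      u \<in> W \<and> v \<in> W \<and> (l \<circ> f) u = a \<and> (l \<circ> f) v = b" for u v
    using join.prems(2) by auto
  then show ?case using cw_graph_join[OF join.IH[OF join.prems] join.hyps(2-)]
    by (simp only: pullback_Un pullback_pairs[OF join.prems(1)])
qed

text \<open>The labels in \<open>A\<close> are merged into \<open>a\<close> one at a time. The label
  \<open>a\<close> itself is skipped, since \<open>CW.relabel\<close> demands two different
  labels.\<close>

lemma cw_graph_relabel_set: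
  assumes "cw_graph k V E l" "finite A" "A \<subseteq> {1..k}" "a \<in> {1..k}"
  shows "cw_graph k V E (\<lambda>v. if l v \<in> A then a else l v)"
  using assms(2,3)
proof (induction A rule: finite_induct)
  case empty then show ?case using assms by simp
next
  case (insert b A)
  show ?case
  proof (cases "b = a")
    case True
    have "cw_graph k V E (\<lambda>v. if l v \<in> A then a else l v)" using insert by simp
    then show ?thesis by (rule cw_graph_cong) (use True in auto)
  next
    case False
    have "cw_graph k V E (\<lambda>v. if l v \<in> A then a else l v)" "b \<in> {1..k}" using insert by simp_all
    from cw_graph_relabel[OF this assms(4) False] show ?thesis
      by (rule cw_graph_cong) auto
  qed
qed

text \<open>The labeling \<open>l \<circ> fst\<close> is the invariant: all vertices of a copy share
  one label, so each operation on the first graph lifts with the same parameters.\<close>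

lemma cw_graph_lex:
  assumes "(V, E, l) \<in> CW k" "(W, F, m) \<in> CW k"
  shows "cw_graph k (V \<times> W) (lex_edges V E W F) (l \<circ> fst)"
  using assms(1)
proof induction
  case (single l v)
  have W: "W \<noteq> {}" "F \<subseteq> {{x, y} | x y. x \<in> W \<and> y \<in> W \<and> x \<noteq> y}" "m ` W \<subseteq> {1..k}"
    using CW_wf[OF assms(2)] by auto
  have "cw_graph k ({v} \<times> W) (pullback snd ({v} \<times> W) F) (m \<circ> snd)"
    using W(1) by (intro cw_graph_pullback[OF assms(2)]) (auto simp: inj_on_def)
  \<comment> \<open>Once the copy is complete its inner labels can be forgotten, so all of
    \<open>{1..k}\<close> is merged into \<open>l v\<close>; hence \<open>k\<close> labels suffice
    for both levels.\<close>
  from cw_graph_relabel_set[OF this, of "{1..k}" "l v"]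
  have "cw_graph k ({v} \<times> W) (pullback snd ({v} \<times> W) F) (l \<circ> fst)"
    by (rule cw_graph_cong) (use single W(3) in auto)
  then show ?case by (simp only: lex_edges_single[OF W(2)])
next
  case (union V E l V' E' l')
  let ?l = "(\<lambda>v. if v \<in> V then l v else l' v) \<circ> fst"
  have "cw_graph k (V \<times> W) (lex_edges V E W F) ?l" "cw_graph k (V' \<times> W) (lex_edges V' E' W F) ?l"
    by (rule cw_graph_cong[OF union.IH(1)], use union.hyps in force)
      (rule cw_graph_cong[OF union.IH(2)], use union.hyps in force)
  then have "cw_graph k (V \<times> W \<union> V' \<times> W) (lex_edges V E W F \<union> lex_edges V' E' W F) ?l"
    using union.hyps(3) by (intro cw_graph_union) auto
  then show ?case using CW_edges_subset[OF union.hyps(1)] CW_edges_subset[OF union.hyps(2)]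
    by (simp only: lex_edges_Un Sigma_Un_distrib1)
next
  case (relabel V E l a b)
  show ?case using cw_graph_relabel[OF relabel.IH relabel.hyps(2-)] by (simp only: comp_def)
next
  case (join V E l a b)
  \<comment> \<open>Including membership in \<open>V\<close> in \<open>?P\<close> supplies the
    hypothesis of \<open>lex_edges_pairs\<close>.\<close>
  let ?P = "\<lambda>u v. u \<in> V \<and> v \<in> V \<and> l u = a \<and> l v = b"
  have "snd p \<in> W \<and> snd q \<in> W \<and> ?P (fst p) (fst q) \<longleftrightarrow>
      p \<in> V \<times> W \<and> q \<in> V \<times> W \<and> (l \<circ> fst) p = a \<and> (l \<circ> fst) q = b" for p q :: "'a \<times> 'b"
    by (auto simp: mem_Times_iff)
  then have "lex_edges V (E \<union> {{u, v} | u v. ?P u v}) W F = lex_edges V E W F \<union>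
      {{p, q} | p q. p \<in> V \<times> W \<and> q \<in> V \<times> W \<and> (l \<circ> fst) p = a \<and> (l \<circ> fst) q = b}"
    by (subst lex_edges_pairs) auto
  then show ?case using cw_graph_join[OF join.IH join.hyps(2-)] by (simp only:)
qed

section \<open>NLC-width expressions\<close>

definition nlc_graph :: "nat \<Rightarrow> 'a set \<Rightarrow> 'a set set \<Rightarrow> ('a \<Rightarrow> nat) \<Rightarrow> bool" where
  "nlc_graph k V E l \<longleftrightarrow> (\<exists>l'. (\<forall>v\<in>V. l' v = l v) \<and> (V, E, l') \<in> NLC k)"

section \<open>NLC operations with labels considered only on the vertex set\<close>

lemma NLC_imp_nlc_graph: "(V, E, l) \<in> NLC k \<Longrightarrow> nlc_graph k V E l"
  by (auto simp: nlc_graph_def)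

lemma nlc_graph_cong: "nlc_graph k V E l \<Longrightarrow> (\<And>v. v \<in> V \<Longrightarrow> l v = l' v) \<Longrightarrow> nlc_graph k V E l'"
  by (auto simp: nlc_graph_def)

lemma nlc_graph_single: "l v \<in> {1..k} \<Longrightarrow> nlc_graph k {v} {} l"
  by (intro NLC_imp_nlc_graph NLC.single)

lemma nlc_graph_union:
  assumes "nlc_graph k V E l" "nlc_graph k V' E' l" "V \<inter> V' = {}" "S \<subseteq> {1..k} \<times> {1..k}"
  shows "nlc_graph k (V \<union> V') (E \<union> E' \<union> {{u, v} | u v. u \<in> V \<and> v \<in> V' \<and> (l u, l v) \<in> S}) l"
proof -
  obtain m m' where m: "\<forall>v\<in>V. m v = l v" "(V, E, m) \<in> NLC k" "\<forall>v\<in>V'. m' v = l v" "(V', E', m') \<in> NLC k"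
    using assms by (auto simp: nlc_graph_def)
  have "u \<in> V \<and> v \<in> V' \<and> (m u, m' v) \<in> S \<longleftrightarrow> u \<in> V \<and> v \<in> V' \<and> (l u, l v) \<in> S" for u v
    using m(1,3) by auto
  then have "(V \<union> V', E \<union> E' \<union> {{u, v} | u v. u \<in> V \<and> v \<in> V' \<and> (l u, l v) \<in> S},
      \<lambda>v. if v \<in> V then m v else m' v) \<in> NLC k"
    using NLC.union[OF m(2,4) assms(3,4)] by simp
  then show ?thesis using m(1,3) assms(3) unfolding nlc_graph_def
    by (intro exI[of _ "\<lambda>v. if v \<in> V then m v else m' v"] conjI) auto
qed

text \<open>Here loops are excluded by disjointness of the operands, since new edges only run
  between \<open>V\<close> and \<open>V'\<close>.\<close>

lemma NLC_wf:
  assumes "(V, E, l) \<in> NLC k"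
  shows "V \<noteq> {} \<and> E \<subseteq> {{u, v} | u v. u \<in> V \<and> v \<in> V \<and> u \<noteq> v} \<and> l ` V \<subseteq> {1..k}"
  using assms
proof induction
  case (union V E l V' E' l' S)
  then show ?case by (simp add: image_subset_iff) blast
qed (auto simp: Pi_iff)

lemma NLC_edges_subset: "(V, E, l) \<in> NLC k \<Longrightarrow> E \<subseteq> Pow V \<and> {} \<notin> E"
  using NLC_wf[of V E l k] by fast

lemma nlc_graph_relabel:
  assumes "nlc_graph k V E l" "R \<in> {1..k} \<rightarrow> {1..k}"
  shows "nlc_graph k V E (\<lambda>v. R (l v))"
proof -
  obtain m where m: "\<forall>v\<in>V. m v = l v" "(V, E, m) \<in> NLC k"
    using assms by (auto simp: nlc_graph_def)
  have "(V, E, \<lambda>v. R (m v)) \<in> NLC k" using m(2) assms(2) by (rule NLC.relabel)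
  then show ?thesis using m(1) unfolding nlc_graph_def
    by (intro exI[of _ "\<lambda>v. R (m v)"] conjI) auto
qed

text \<open>Unlike for \<open>CW\<close>, a relabeling has to be extended to the larger label set,
  which can alter labels outside \<open>V\<close>; hence \<open>nlc_graph\<close> in the
  conclusion.\<close>

lemma nlc_graph_mono:
  assumes "(V, E, l) \<in> NLC k" "k \<le> k'"
  shows "nlc_graph k' V E l"
  using assms(1)
proof induction
  case (single l v) then show ?case using assms(2) by (intro nlc_graph_single) auto
next
  case (union V E l V' E' l' S)
  let ?l = "\<lambda>v. if v \<in> V then l v else l' v"
  have "nlc_graph k' V E ?l" "nlc_graph k' V' E' ?l"
    by (rule nlc_graph_cong[OF union.IH(1)], use union.hyps in force)
      (rule nlc_graph_cong[OF union.IH(2)], use union.hyps in force)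
  moreover have "S \<subseteq> {1..k'} \<times> {1..k'}" using union.hyps assms(2) by fastforce
  ultimately have "nlc_graph k' (V \<union> V')
      (E \<union> E' \<union> {{u, v} | u v. u \<in> V \<and> v \<in> V' \<and> (?l u, ?l v) \<in> S}) ?l"
    using union.hyps(3) by (intro nlc_graph_union)
  moreover have "u \<in> V \<and> v \<in> V' \<and> (?l u, ?l v) \<in> S \<longleftrightarrow> u \<in> V \<and> v \<in> V' \<and> (l u, l' v) \<in> S" for u v
    using union.hyps(3) by auto
  ultimately show ?case by (simp only:)
next
  case (relabel V E l R)
  \<comment> \<open>\<open>R\<close> is uncontrolled above \<open>k\<close>, so it is continued by
    the identity; on \<open>V\<close> nothing changes because the labels there lie in
    \<open>{1..k}\<close>.\<close>
  let ?R = "\<lambda>i. if i \<in> {1..k} then R i else i"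
  have "?R \<in> {1..k'} \<rightarrow> {1..k'}" using relabel.hyps assms(2) by (fastforce simp: Pi_iff)
  from nlc_graph_relabel[OF relabel.IH this] show ?case
    by (rule nlc_graph_cong) (use NLC_wf[OF relabel.hyps(1)] in auto)
qed

lemma NLC_mono_ex: "(V, E, l) \<in> NLC k \<Longrightarrow> k \<le> k' \<Longrightarrow> \<exists>l. (V, E, l) \<in> NLC k'"
  using nlc_graph_mono unfolding nlc_graph_def by blast

text \<open>Leaves are dropped as for clique-width; the same relation \<open>S\<close> then creates
  exactly the surviving cross edges.\<close>

lemma nlc_graph_pullback:
  assumes "(V, E, l) \<in> NLC k" "inj_on f W" "f ` W \<subseteq> V" "W \<noteq> {}"
  shows "nlc_graph k W (pullback f W E) (l \<circ> f)"
  using assms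
proof (induction arbitrary: W)
  case (single l v)
  obtain w where "w \<in> W" using single.prems(3) by blast
  then have "W = {w}" "f w = v" using single.prems by (auto dest: inj_onD)
  then show ?case using single by (auto intro: nlc_graph_single)
next
  case (union V E l V' E' l' S)
  define W1 where "W1 = {w \<in> W. f w \<in> V}"
  define W2 where "W2 = {w \<in> W. f w \<in> V'}"
  have W: "W = W1 \<union> W2" "W1 \<inter> W2 = {}" "inj_on f W1" "inj_on f W2" "f ` W1 \<subseteq> V" "f ` W2 \<subseteq> V'"
    using union.prems union.hyps by (auto simp: W1_def W2_def intro: inj_on_subset)
  let ?l = "(\<lambda>v. if v \<in> V then l v else l' v) \<circ> f"
  have left: "nlc_graph k W1 (pullback f W E) ?l" if "W1 \<noteq> {}"
  proof -
    have "pullback f W1 E = pullback f W E"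
      unfolding W1_def using NLC_edges_subset[OF union.hyps(1)] by (intro pullback_restrict) blast
    then have "nlc_graph k W1 (pullback f W E) (l \<circ> f)"
      using union.IH(1)[OF W(3,5) that] by (simp only:)
    then show ?thesis by (rule nlc_graph_cong) (use union.hyps(3) in \<open>auto simp: W1_def\<close>)
  qed
  have right: "nlc_graph k W2 (pullback f W E') ?l" if "W2 \<noteq> {}"
  proof -
    have "pullback f W2 E' = pullback f W E'"
      unfolding W2_def using NLC_edges_subset[OF union.hyps(2)] by (intro pullback_restrict) blast
    then have "nlc_graph k W2 (pullback f W E') (l' \<circ> f)"
      using union.IH(2)[OF W(4,6) that] by (simp only:)
    then show ?thesis by (rule nlc_graph_cong) (use union.hyps(3) in \<open>auto simp: W2_def\<close>)
  qed
  \<comment> \<open>The right-hand side is empty as soon as \<open>W1\<close> or \<open>W2\<close>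
    is, which settles the cross edges in the degenerate cases below.\<close>
  have J: "pullback f W {{u, v} | u v. u \<in> V \<and> v \<in> V' \<and> (l u, l' v) \<in> S} =
      {{u, v} | u v. u \<in> W1 \<and> v \<in> W2 \<and> (?l u, ?l v) \<in> S}"
  proof -
    have "u \<in> W \<and> v \<in> W \<and> f u \<in> V \<and> f v \<in> V' \<and> (l (f u), l' (f v)) \<in> S \<longleftrightarrow>
        u \<in> W1 \<and> v \<in> W2 \<and> (?l u, ?l v) \<in> S" for u v
      using union.hyps(3) by (auto simp: W1_def W2_def)
    then show ?thesis by (simp add: pullback_pairs[OF union.prems(1)])
  qed
  consider "W1 = {}" "W2 = W" | "W2 = {}" "W1 = W" | "W1 \<noteq> {}" "W2 \<noteq> {}" using W by auto
  then show ?case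
  proof cases
    case 1
    then have "pullback f W E = {}"
      using NLC_edges_subset[OF union.hyps(1)] by (intro pullback_disjoint[of E V]) (auto simp: W1_def)
    with right 1 show ?thesis using union.prems(3) by (simp add: pullback_Un J comp_def)
  next
    case 2
    then have "pullback f W E' = {}"
      using NLC_edges_subset[OF union.hyps(2)] by (intro pullback_disjoint[of E' V']) (auto simp: W2_def)
    with left 2 show ?thesis using union.prems(3) by (simp add: pullback_Un J comp_def)
  next
    case 3
    show ?thesis using nlc_graph_union[OF left[OF 3(1)] right[OF 3(2)] W(2) union.hyps(4)]
      by (simp only: pullback_Un J W(1)[symmetric])
  qed
next
  case (relabel V E l R)
  show ?case using nlc_graph_relabel[OF relabel.IH[OF relabel.prems] relabel.hyps(2-)] by (simp only: comp_def)
qed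

text \<open>The invariant \<open>l \<circ> fst\<close> is again that every copy carries one label,
  so \<open>S\<close> treats a copy as a single vertex.\<close>

lemma nlc_graph_lex:
  assumes "(V, E, l) \<in> NLC k" "(W, F, m) \<in> NLC k"
  shows "nlc_graph k (V \<times> W) (lex_edges V E W F) (l \<circ> fst)"
  using assms(1)
proof induction
  case (single l v)
  have W: "W \<noteq> {}" "F \<subseteq> {{x, y} | x y. x \<in> W \<and> y \<in> W \<and> x \<noteq> y}"
    using NLC_wf[OF assms(2)] by auto
  have "nlc_graph k ({v} \<times> W) (pullback snd ({v} \<times> W) F) (m \<circ> snd)"
    using W(1) by (intro nlc_graph_pullback[OF assms(2)]) (auto simp: inj_on_def)
  \<comment> \<open>A constant function merges all labels of the copy in one operation.\<close>
  from nlc_graph_relabel[OF this, of "\<lambda>_. l v"]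
  have "nlc_graph k ({v} \<times> W) (pullback snd ({v} \<times> W) F) (l \<circ> fst)"
    by (rule nlc_graph_cong) (use single in auto)
  then show ?case by (simp only: lex_edges_single[OF W(2)])
next
  case (union V E l V' E' l' S)
  let ?l = "(\<lambda>v. if v \<in> V then l v else l' v) \<circ> fst"
  let ?P = "\<lambda>u v. u \<in> V \<and> v \<in> V' \<and> (l u, l' v) \<in> S"
  have lab: "nlc_graph k (V \<times> W) (lex_edges V E W F) ?l" "nlc_graph k (V' \<times> W) (lex_edges V' E' W F) ?l"
    by (rule nlc_graph_cong[OF union.IH(1)], use union.hyps in force)
      (rule nlc_graph_cong[OF union.IH(2)], use union.hyps in force)
  have disj: "V \<times> W \<inter> V' \<times> W = {}" using union.hyps(3) by auto
  have "snd p \<in> W \<and> snd q \<in> W \<and> ?P (fst p) (fst q) \<longleftrightarrow>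
      p \<in> V \<times> W \<and> q \<in> V' \<times> W \<and> (?l p, ?l q) \<in> S" for p q :: "'a \<times> 'b"
    using union.hyps(3) by (auto simp: mem_Times_iff)
  \<comment> \<open>First \<open>lex_edges_pairs\<close> splits off the cross edges over
    \<open>V \<union> V'\<close>, then \<open>lex_edges_Un\<close> separates the two
    operands.\<close>
  then have "lex_edges (V \<union> V') (E \<union> E' \<union> {{u, v} | u v. ?P u v}) W F =
      lex_edges V E W F \<union> lex_edges V' E' W F \<union>
      {{p, q} | p q. p \<in> V \<times> W \<and> q \<in> V' \<times> W \<and> (?l p, ?l q) \<in> S}"
    using NLC_edges_subset[OF union.hyps(1)] NLC_edges_subset[OF union.hyps(2)]
    by (subst lex_edges_pairs) (auto simp: lex_edges_Un)
  then show ?case using nlc_graph_union[OF lab disj union.hyps(4)]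
    by (simp only: Sigma_Un_distrib1)
next
  case (relabel V E l R)
  show ?case using nlc_graph_relabel[OF relabel.IH relabel.hyps(2-)] by (simp only: comp_def)
qed

section \<open>Widths\<close>

text \<open>The larger of the two minima belongs to both sets by upward closure.\<close>

lemma Inf_enat_Int_upward_closed:
  fixes A B :: "nat set"
  assumes "\<And>i j. i \<in> A \<Longrightarrow> i \<le> j \<Longrightarrow> j \<in> A" "\<And>i j. i \<in> B \<Longrightarrow> i \<le> j \<Longrightarrow> j \<in> B"
  shows "Inf (enat ` (A \<inter> B)) = max (Inf (enat ` A)) (Inf (enat ` B))"
proof (rule antisym)
  show "max (Inf (enat ` A)) (Inf (enat ` B)) \<le> Inf (enat ` (A \<inter> B))"
    by (auto intro: Inf_superset_mono)
  show "Inf (enat ` (A \<inter> B)) \<le> max (Inf (enat ` A)) (Inf (enat ` B))"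
  proof (cases "A = {} \<or> B = {}")
    \<comment> \<open>An empty set has infimum \<open>\<infinity>\<close>, so the maximum is the top
      element; this covers graphs without vertices.\<close>
    case True
    then show ?thesis by (auto simp: top_enat_def)
  next
    case False
    define a b where "a = (LEAST i. i \<in> A)" and "b = (LEAST i. i \<in> B)"
    have "a \<in> A" "b \<in> B" using False by (auto simp: a_def b_def intro: LeastI)
    then have "max a b \<in> A \<inter> B" using assms by (meson IntI max.cobounded1 max.cobounded2)
    then have "Inf (enat ` (A \<inter> B)) \<le> enat (max a b)" by (intro Inf_lower) auto
    also have "\<dots> = max (enat a) (enat b)" by (simp add: max_def)
    also have "enat a = Inf (enat ` A)"
      using Inf_enat_image_eq_Least[of "\<lambda>i. i \<in> A"] False unfolding a_def by (metis Collect_mem_eq ex_in_conv)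
    also have "enat b = Inf (enat ` B)"
      using Inf_enat_image_eq_Least[of "\<lambda>i. i \<in> B"] False unfolding b_def by (metis Collect_mem_eq ex_in_conv)
    finally show ?thesis .
  qed
qed

text \<open>The equivalence holds for each fixed \<open>k\<close>, so the admissible
  \<open>k\<close> of the product are the intersection of those of the factors. If a factor has no
  vertices, both sides are false.\<close>

lemma CW_lex_product_iff:
  assumes "simple_graph G1" "simple_graph G2"
  defines "G \<equiv> lex_product G1 G2"
  shows "(\<exists>l. (fst G, snd G, l) \<in> CW k) \<longleftrightarrow>
    (\<exists>l. (fst G1, snd G1, l) \<in> CW k) \<and> (\<exists>l. (fst G2, snd G2, l) \<in> CW k)"
proof -
  obtain V E W F where G12: "G1 = (V, E)" "G2 = (W, F)" by (cases G1, cases G2)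
  have G: "G = (V \<times> W, lex_edges V E W F)" by (simp add: G_def G12 lex_product_eq)
  have E: "E \<subseteq> {{u, v} | u v. u \<in> V \<and> v \<in> V \<and> u \<noteq> v}" and F: "F \<subseteq> {{u, v} | u v. u \<in> W \<and> v \<in> W \<and> u \<noteq> v}"
    using assms by (auto simp: simple_graph_def G12)
  have "(\<exists>l. (V, E, l) \<in> CW k) \<and> (\<exists>l. (W, F, l) \<in> CW k)" if l: "(V \<times> W, lex_edges V E W F, l) \<in> CW k" for l
  proof -
    \<comment> \<open>An expression has at least one vertex, so both factors provide a base point at
      which the other factor embeds as a slice.\<close>
    obtain x y where xy: "x \<in> V" "y \<in> W" using CW_wf[OF l] by auto
    have "cw_graph k V E (l \<circ> (\<lambda>u. (u, y)))"
      using cw_graph_pullback[OF l, of "\<lambda>u. (u, y)" V] xy pullback_lex_fst[OF E F xy(2)] by (auto simp: inj_on_def)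
    moreover have "cw_graph k W F (l \<circ> Pair x)"
      using cw_graph_pullback[OF l, of "Pair x" W] xy pullback_lex_snd[OF E F xy(1)] by (auto simp: inj_on_def)
    ultimately show ?thesis by (auto simp: cw_graph_def)
  qed
  moreover have "\<exists>l. (V \<times> W, lex_edges V E W F, l) \<in> CW k" if "(V, E, l) \<in> CW k" "(W, F, l') \<in> CW k" for l l'
    using cw_graph_lex[OF that] by (auto simp: cw_graph_def)
  ultimately show ?thesis by (auto simp: G G12)
qed

lemma NLC_lex_product_iff:
  assumes "simple_graph G1" "simple_graph G2"
  defines "G \<equiv> lex_product G1 G2"
  shows "(\<exists>l. (fst G, snd G, l) \<in> NLC k) \<longleftrightarrow>
    (\<exists>l. (fst G1, snd G1, l) \<in> NLC k) \<and> (\<exists>l. (fst G2, snd G2, l) \<in> NLC k)"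
proof -
  obtain V E W F where G12: "G1 = (V, E)" "G2 = (W, F)" by (cases G1, cases G2)
  have G: "G = (V \<times> W, lex_edges V E W F)" by (simp add: G_def G12 lex_product_eq)
  have E: "E \<subseteq> {{u, v} | u v. u \<in> V \<and> v \<in> V \<and> u \<noteq> v}" and F: "F \<subseteq> {{u, v} | u v. u \<in> W \<and> v \<in> W \<and> u \<noteq> v}"
    using assms by (auto simp: simple_graph_def G12)
  have "(\<exists>l. (V, E, l) \<in> NLC k) \<and> (\<exists>l. (W, F, l) \<in> NLC k)" if l: "(V \<times> W, lex_edges V E W F, l) \<in> NLC k" for l
  proof -
    obtain x y where xy: "x \<in> V" "y \<in> W" using NLC_wf[OF l] by auto
    have "nlc_graph k V E (l \<circ> (\<lambda>u. (u, y)))"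
      using nlc_graph_pullback[OF l, of "\<lambda>u. (u, y)" V] xy pullback_lex_fst[OF E F xy(2)] by (auto simp: inj_on_def)
    moreover have "nlc_graph k W F (l \<circ> Pair x)"
      using nlc_graph_pullback[OF l, of "Pair x" W] xy pullback_lex_snd[OF E F xy(1)] by (auto simp: inj_on_def)
    ultimately show ?thesis by (auto simp: nlc_graph_def)
  qed
  moreover have "\<exists>l. (V \<times> W, lex_edges V E W F, l) \<in> NLC k" if "(V, E, l) \<in> NLC k" "(W, F, l') \<in> NLC k" for l l'
    using nlc_graph_lex[OF that] by (auto simp: nlc_graph_def)
  ultimately show ?thesis by (auto simp: G G12)
qed

theorem theorem1:
  fixes G1 :: "'a graph" and G2 :: "'b graph"
  assumes "simple_graph G1" and "simple_graph G2"
  shows "nlc_width (lex_product G1 G2) = max (nlc_width G1) (nlc_width G2) \<and>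
         clique_width (lex_product G1 G2) = max (clique_width G1) (clique_width G2)"
proof
  let ?N1 = "{k. k \<ge> 1 \<and> (\<exists>l. (fst G1, snd G1, l) \<in> NLC k)}"
  let ?N2 = "{k. k \<ge> 1 \<and> (\<exists>l. (fst G2, snd G2, l) \<in> NLC k)}"
  \<comment> \<open>The sets of admissible \<open>k\<close> are upward closed by monotonicity in the
    number of labels.\<close>
  have "Inf (enat ` (?N1 \<inter> ?N2)) = max (Inf (enat ` ?N1)) (Inf (enat ` ?N2))"
    by (rule Inf_enat_Int_upward_closed) (blast intro: NLC_mono_ex le_trans)+
  moreover have "?N1 \<inter> ?N2 = {k. k \<ge> 1 \<and> (\<exists>l. (fst (lex_product G1 G2), snd (lex_product G1 G2), l) \<in> NLC k)}"
    using NLC_lex_product_iff[OF assms] by auto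
  ultimately show "nlc_width (lex_product G1 G2) = max (nlc_width G1) (nlc_width G2)"
    by (simp add: nlc_width_def)
  let ?C1 = "{k. k \<ge> 1 \<and> (\<exists>l. (fst G1, snd G1, l) \<in> CW k)}"
  let ?C2 = "{k. k \<ge> 1 \<and> (\<exists>l. (fst G2, snd G2, l) \<in> CW k)}"
  have "Inf (enat ` (?C1 \<inter> ?C2)) = max (Inf (enat ` ?C1)) (Inf (enat ` ?C2))"
    by (rule Inf_enat_Int_upward_closed) (blast intro: CW_mono le_trans)+
  moreover have "?C1 \<inter> ?C2 = {k. k \<ge> 1 \<and> (\<exists>l. (fst (lex_product G1 G2), snd (lex_product G1 G2), l) \<in> CW k)}"
    using CW_lex_product_iff[OF assms] by auto
  ultimately show "clique_width (lex_product G1 G2) = max (clique_width G1) (clique_width G2)"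
    by (simp add: clique_width_def)
qed

end
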